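(* The joint spectral radius for the generators $\Sigma=\{S_1,S_2,S_3,S_4\}$ of the Apollonian group is $\sigma(\Sigma)=\theta^{1/4}$, where $$\theta=\frac12\left(1+\sqrt5+\sqrt{2+2\sqrt5}\right)\approx2.890.$$ It is attained by $M=S_4S_3S_2S_1$.
   Context: For $1\le i\le4$, $S_i$ is the $4\times4$ integer matrix that sends a column vector $(v_1,v_2,v_3,v_4)^T$ to the vector with $v_i$ replaced by $2\sum_{j\ne i}v_j-v_i$ and the other entries unchanged. The Apollonian group is the group generated by $S_1,S_2,S_3,S_4$. For a square matrix $M$, $\sigma(M)=\max\{|\lambda|:\lambda\text{ an eigenvalue of }M\}$ is its spectral radius. The joint spectral radius of a finite set $\Sigma=\{M_1,\dots,M_s\}$ of $n\times n$ matrices is $$\sigma(\Sigma)=\limsup_{k\to\infty}\left\{\max_{1\le i_1,\dots,i_k\le s}\sigma(M_{i_1}\cdots M_{i_k})^{1/k}\right\}.$$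
   Formalization: The printed value σ(Σ)=θ^{1/4} is false for the displayed θ, since S_4S_3S_2S_1 has eigenvalue θ^4; the statement proved is σ(Σ)=θ, with θ as displayed (≈2.890), attained as σ(M)^{1/4}=σ(Σ). *)

theory Defs
  imports "Jordan_Normal_Form.Spectral_Radius" "HOL-Library.Extended_Real" "HOL-Library.Liminf_Limsup"
begin

text \<open>Rows and columns are 0-based in the matrix library, while the matrices
  \<open>S\<^sub>1, \<dots>, S\<^sub>4\<close> are numbered from 1: the exceptional row of \<open>S\<^sub>i\<close> has library index \<open>i - 1\<close>.\<close>

definition apollonian_S :: "nat \<Rightarrow> int mat" where
  "apollonian_S i = mat 4 4 (\<lambda>(r, c).
     if Suc r = i then (if c = r then - 1 else 2) else (if c = r then 1 else 0))"

lemma apollonian_S_carrier [simp]: "apollonian_S i \<in> carrier_mat 4 4"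
  by (simp add: apollonian_S_def)

lemma apollonian_S_mult_vec:
  assumes v: "v \<in> carrier_vec 4"
  shows "apollonian_S i *\<^sub>v v =
    vec 4 (\<lambda>r. if Suc r = i then 2 * (\<Sum>j\<in>{0..<4} - {r}. v $ j) - v $ r else v $ r)"
proof (rule eq_vecI)
  fix r assume "r < dim_vec (vec 4 (\<lambda>r. if Suc r = i
    then 2 * (\<Sum>j\<in>{0..<4} - {r}. v $ j) - v $ r else v $ r))"
  then have r: "r < 4" by simp
  have "(apollonian_S i *\<^sub>v v) $ r = (\<Sum>j\<in>{0..<4}. apollonian_S i $$ (r, j) * v $ j)"
    using r v by (simp add: apollonian_S_def scalar_prod_def)
  also have "\<dots> = apollonian_S i $$ (r, r) * v $ r
      + (\<Sum>j\<in>{0..<4} - {r}. apollonian_S i $$ (r, j) * v $ j)"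
    using r by (subst sum.remove[of _ r]) auto
  also have "(\<Sum>j\<in>{0..<4} - {r}. apollonian_S i $$ (r, j) * v $ j) =
      (\<Sum>j\<in>{0..<4} - {r}. (if Suc r = i then 2 else 0) * v $ j)"
    using r by (intro sum.cong) (auto simp: apollonian_S_def)
  also have "\<dots> = (if Suc r = i then 2 else 0) * (\<Sum>j\<in>{0..<4} - {r}. v $ j)"
    by (simp add: sum_distrib_left)
  finally show "(apollonian_S i *\<^sub>v v) $ r = vec 4 (\<lambda>r. if Suc r = i
      then 2 * (\<Sum>j\<in>{0..<4} - {r}. v $ j) - v $ r else v $ r) $ r"
    using r by (simp add: apollonian_S_def)
qed (simp add: apollonian_S_def)

text \<open>The spectral radius of the library is defined for complex matrices.\<close>

abbreviation apollonian_Sc :: "nat \<Rightarrow> complex mat" where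
  "apollonian_Sc i \<equiv> map_mat of_int (apollonian_S i)"

definition mat_prod_list :: "nat \<Rightarrow> 'a :: semiring_1 mat list \<Rightarrow> 'a mat" where
  "mat_prod_list n Ms = foldr (*) Ms (1\<^sub>m n)"

text \<open>Intended for a finite nonempty set of \<open>n \<times> n\<close> matrices. The value is an extended real,
  so that the limit superior has its usual meaning whether or not the sequence is bounded.
  Only \<open>k \<ge> 1\<close> matters: the term at \<open>k = 0\<close> does not affect the limit superior.\<close>

definition joint_spectral_radius :: "nat \<Rightarrow> complex mat set \<Rightarrow> ereal" where
  "joint_spectral_radius n \<Sigma> = limsup (\<lambda>k. ereal
     (Max {spectral_radius (mat_prod_list n Ms) powr (1 / real k) | Ms.
        length Ms = k \<and> set Ms \<subseteq> \<Sigma>}))"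

end

theory Submission
  imports Defs
begin

text \<open>
  Since \<open>S\<^sub>i\<close> is an involution, cancelling repeated letters only shortens a word. Along a word
  without repeated letters, started at a nonnegative vector whose largest entry is not the first
  one changed, entries stay nonnegative and the entry changed last is the largest one. Growth is
  then fastest when one always changes the smallest entry, that is for the cyclic word
  \<open>\<dots> S\<^sub>4 S\<^sub>3 S\<^sub>2 S\<^sub>1\<close>, where it follows the recurrence \<open>u\<^sub>n\<^sub>+\<^sub>4 = 2 (u\<^sub>n\<^sub>+\<^sub>3 + u\<^sub>n\<^sub>+\<^sub>2 + u\<^sub>n\<^sub>+\<^sub>1) - u\<^sub>n\<close> with
  dominant root \<open>\<theta>\<close>. The left eigenvector of this recurrence, evaluated on the entries in
  decreasing order, is a potential that grows by a factor of at most \<open>\<theta>\<close> in each step. Hence the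
  entries of every product of \<open>k\<close> generators are \<open>O(\<theta>\<^sup>k)\<close>; applied to the powers of a word this
  bounds its spectral radius by \<open>\<theta>\<^sup>k\<close>, and the cyclic word of length 4 has the eigenvalue \<open>\<theta>\<^sup>4\<close>.
\<close>

section \<open>The root theta and the potential\<close>

definition theta :: real where
  "theta = (1 / 2) * (1 + sqrt 5 + sqrt (2 + 2 * sqrt 5))"

text \<open>Tight enough for the numerical claim, which needs theta strictly between 2.8895 and
  2.8905.\<close>

lemma theta_bounds: "2.8897 < theta" "theta < 2.8904"
proof -
  have s: "2.236 < sqrt 5" "sqrt 5 < 2.2361"
    by (rule real_less_rsqrt real_less_lsqrt; simp add: power2_eq_square)+
  have "2.5438 < sqrt (2 + 2 * sqrt 5)"
    using s by (intro real_less_rsqrt) (simp add: power2_eq_square)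
  moreover have "sqrt (2 + 2 * sqrt 5) < 2.5443"
    using s by (intro real_less_lsqrt) (simp_all add: power2_eq_square)
  ultimately show "2.8897 < theta" "theta < 2.8904"
    using s by (simp_all add: theta_def)
qed

text \<open>The quartic is palindromic: divided by theta^2 it becomes y^2 - 2*y - 4 = 0 for y =
  theta + 1/theta, and \<open>y\<close> below is the root 1 + sqrt 5.\<close>

lemma theta_pow4: "theta ^ 4 = 2 * theta ^ 3 + 2 * theta ^ 2 + 2 * theta - 1"
proof -
  define y where "y = 1 + sqrt 5"
  have y: "y ^ 2 = 2 * y + 4"
    by (simp add: y_def power2_eq_square algebra_simps)
  have "(2 * theta - y) ^ 2 = 2 * y"
    by (simp add: theta_def y_def field_simps)
  then have "theta ^ 2 + 1 = y * theta"
    using y by (simp add: power2_eq_square algebra_simps)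
  then have "(theta ^ 2 + 1) ^ 2 = 2 * theta * (y * theta) + 4 * theta ^ 2"
    using y by (simp add: power_mult_distrib) (simp add: power2_eq_square algebra_simps)
  also have "\<dots> = 2 * theta * (theta ^ 2 + 1) + 4 * theta ^ 2"
    using \<open>theta ^ 2 + 1 = y * theta\<close> by simp
  finally show ?thesis
    by (simp add: power4_eq_xxxx power3_eq_cube power2_eq_square algebra_simps)
qed

text \<open>Comparing the coefficients of a, b and c in \<open>potential_step\<close> forces these
  three values; the coefficient of d leaves the condition \<open>theta_c3\<close>.\<close>

definition c1 :: real where "c1 = theta - 2"
definition c2 :: real where "c2 = theta * c1 - 2"
definition c3 :: real where "c3 = theta * c2 - 2"

definition potential :: "real \<Rightarrow> real \<Rightarrow> real \<Rightarrow> real \<Rightarrow> real" where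
  "potential a b c d = a + c1 * b + c2 * c + c3 * d"

lemma theta_c3: "theta * c3 = - 1"
  using theta_pow4
  by (simp add: c3_def c2_def c1_def power4_eq_xxxx power3_eq_cube power2_eq_square algebra_simps)

lemma coeff_bounds: "0 \<le> c1" "c1 \<le> 1" "0.5 \<le> c2" "c2 \<le> 1" "- 0.5 \<le> c3" "c3 \<le> 0"
proof -
  \<comment> \<open>Running the recursion backwards from c3 turns each bound on c3 and c2 into a
    linear inequality once the denominator is cleared.\<close>
  have c3: "c3 = - 1 / theta"
    using theta_c3 theta_bounds by (simp add: field_simps)
  then show 3: "- 0.5 \<le> c3" "c3 \<le> 0"
    using theta_bounds unfolding c3 by (simp_all add: field_simps)
  have c2: "c2 = (2 + c3) / theta"
    using theta_bounds by (simp add: c3_def)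
  then show "0.5 \<le> c2" "c2 \<le> 1"
    using theta_bounds 3 unfolding c2 by (simp_all add: field_simps)
  show "0 \<le> c1" "c1 \<le> 1"
    using theta_bounds by (simp_all add: c1_def)
qed

text \<open>(1, c1, c2, c3) is a left eigenvector of the map that replaces the last entry and moves
  the new value to the front.\<close>

lemma potential_step:
  "potential (2 * (a + b + c) - d) a b c = theta * potential a b c d"
proof -
  have "theta * potential a b c d
      = theta * a + (theta * c1) * b + (theta * c2) * c + (theta * c3) * d"
    by (simp add: potential_def algebra_simps)
  also have "\<dots> = (c1 + 2) * a + (c2 + 2) * b + (c3 + 2) * c - d"
    by (simp add: theta_c3) (simp add: c1_def c2_def c3_def)
  finally show ?thesis
    by (simp add: potential_def algebra_simps)
qed

text \<open>Changing d rather than c yields (3 + c3) * (c - d) more, so the smaller entry is the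
  better choice. \<open>potential_step_le2\<close> telescopes through two such exchanges.\<close>

lemma potential_step_le3:
  assumes "d \<le> c"
  shows "potential (2 * (a + b + d) - c) a b d \<le> theta * potential a b c d"
proof -
  have "potential (2 * (a + b + c) - d) a b c - potential (2 * (a + b + d) - c) a b d
      = (3 + c3) * (c - d)"
    by (simp add: potential_def algebra_simps)
  moreover have "0 \<le> (3 + c3) * (c - d)"
    using assms coeff_bounds by (intro mult_nonneg_nonneg) auto
  ultimately show ?thesis
    by (simp flip: potential_step)
qed

lemma potential_step_le2:
  assumes "d \<le> c" "c \<le> b"
  shows "potential (2 * (a + c + d) - b) a c d \<le> theta * potential a b c d"
proof -
  have "potential (2 * (a + b + c) - d) a b c - potential (2 * (a + c + d) - b) a c d
      = (3 + c2) * (b - c) + (3 + c3) * (c - d)"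
    by (simp add: potential_def algebra_simps)
  moreover have "0 \<le> (3 + c2) * (b - c)" "0 \<le> (3 + c3) * (c - d)"
    using assms coeff_bounds by (auto intro!: mult_nonneg_nonneg)
  ultimately show ?thesis
    by (simp flip: potential_step)
qed

text \<open>Only c3 is negative, and c2 * c absorbs c3 * d because d <= c and -c3 <= 0.5 <= c2. This
  converts a bound on the potential into one on the largest entry.\<close>

lemma potential_ge:
  assumes "0 \<le> d" "d \<le> c" "c \<le> b"
  shows "a \<le> potential a b c d"
proof -
  have "0 \<le> c1 * b" "0.5 * d \<le> c2 * c" "- 0.5 * d \<le> c3 * d"
    using assms coeff_bounds by (intro mult_nonneg_nonneg mult_mono mult_right_mono; simp)+
  then show ?thesis
    by (simp add: potential_def)
qed

section \<open>Words acting on coordinate functions\<close>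

text \<open>The sum includes \<open>v i\<close> itself, hence the factor 3. Letters are 0-based, and
  the type is left open because growth is estimated over the reals while eigenvectors are
  complex.\<close>

definition step :: "nat \<Rightarrow> (nat \<Rightarrow> 'a::comm_ring_1) \<Rightarrow> nat \<Rightarrow> 'a" where
  "step i v = v(i := 2 * (\<Sum>j<4. v j) - 3 * v i)"

lemma step_eqI: "2 * (\<Sum>j<4. v j) - 3 * v i = a \<Longrightarrow> step i v = v(i := a)"
  by (simp add: step_def)

text \<open>As in a matrix product, the last letter acts first, so the head of a word is the entry
  changed last.\<close>

definition act :: "nat list \<Rightarrow> (nat \<Rightarrow> 'a::comm_ring_1) \<Rightarrow> nat \<Rightarrow> 'a" where
  "act w v = foldr step w v"

lemma act_Nil [simp]: "act [] v = v"
  and act_Cons [simp]: "act (i # w) v = step i (act w v)"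
  by (simp_all add: act_def)

lemma sum_lessThan_4: "(\<Sum>j<4. f j) = f 0 + f 1 + f 2 + f 3" for f :: "nat \<Rightarrow> 'a::comm_monoid_add"
  by (simp add: eval_nat_numeral ac_simps)

lemma less_4_cases:
  assumes "i < (4::nat)"
  obtains "i = 0" | "i = 1" | "i = 2" | "i = 3"
  using assms by linarith

lemma step_step:
  assumes "i < 4"
  shows "step i (step i v) = v"
  using assms by (cases rule: less_4_cases) (auto simp: step_def sum_lessThan_4 fun_eq_iff)

lemma reduced_word:
  assumes "set w \<subseteq> {..<4}"
  obtains w' where "set w' \<subseteq> {..<4}" "distinct_adj w'" "length w' \<le> length w"
    "\<And>v :: nat \<Rightarrow> 'a::comm_ring_1. act w' v = act w v"
proof -
  have "\<exists>w'. set w' \<subseteq> {..<4} \<and> distinct_adj w' \<and> length w' \<le> length w \<and>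
      (\<forall>v :: nat \<Rightarrow> 'a. act w' v = act w v)"
    using assms
  proof (induction w)
    case (Cons i w)
    then obtain w' where w': "set w' \<subseteq> {..<4}" "distinct_adj w'" "length w' \<le> length w"
      "\<And>v :: nat \<Rightarrow> 'a. act w' v = act w v" by auto
    show ?case
    \<comment> \<open>If the reduced tail begins with i, the new letter cancels against it by
      \<open>step_step\<close>; otherwise prepending i keeps the word reduced.\<close>
    proof (cases "w' \<noteq> [] \<and> hd w' = i")
      case True
      then obtain u where u: "w' = i # u" by (cases w') auto
      have "act u v = step i (act w v)" for v :: "nat \<Rightarrow> 'a"
        using w'(4)[of v] Cons.prems u by (simp add: step_step flip: w'(4))
      then show ?thesis
        using w' u by (intro exI[of _ u]) (auto simp: distinct_adj_Cons)
    next
      case False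
      then show ?thesis
        using w' Cons.prems by (intro exI[of _ "i # w'"]) (auto simp: distinct_adj_Cons)
    qed
  qed auto
  then show thesis using that by blast
qed

section \<open>Growth along reduced words\<close>

text \<open>Ties are allowed, so i need not be determined by v; the starting vectors exploit this
  freedom.\<close>

definition ordered_state :: "(nat \<Rightarrow> real) \<Rightarrow> nat \<Rightarrow> real \<Rightarrow> bool" where
  "ordered_state v i B \<longleftrightarrow> (\<exists>j k l. {i, j, k, l} = {..<4} \<and> distinct [i, j, k, l] \<and>
     0 \<le> v l \<and> v l \<le> v k \<and> v k \<le> v j \<and> v j \<le> v i \<and> potential (v i) (v j) (v k) (v l) \<le> B)"

lemma ordered_stateI:
  assumes "{i, j, k, l} = {..<4}" "distinct [i, j, k, l]"
    and "0 \<le> v l" "v l \<le> v k" "v k \<le> v j" "v j \<le> v i"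
    and "potential (v i) (v j) (v k) (v l) \<le> B"
  shows "ordered_state v i B"
  using assms unfolding ordered_state_def by blast

lemma sum_of_enumeration_4:
  fixes v :: "nat \<Rightarrow> real"
  assumes "{i, j, k, l} = {..<4}" "distinct [i, j, k, l]"
  shows "(\<Sum>m<4. v m) = v i + v j + v k + v l"
  using assms(2) by (simp flip: assms(1))

text \<open>Since 0 <= v m <= v i and m differs from i, the new entry is at least 2 * v i - v m >= v
  i. It moves to the front and the others keep their order; the cases below are the possible ranks
  of m.\<close>

lemma ordered_state_step:
  assumes "ordered_state v i B" "m < 4" "m \<noteq> i"
  shows "ordered_state (step m v) m (theta * B)"
proof -
  obtain j k l where jkl: "{i, j, k, l} = {..<4}" "distinct [i, j, k, l]"
    and v: "0 \<le> v l" "v l \<le> v k" "v k \<le> v j" "v j \<le> v i"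
    and B: "potential (v i) (v j) (v k) (v l) \<le> B"
    using assms(1) by (auto simp: ordered_state_def)
  have s: "step m v = v(m := 2 * (v i + v j + v k + v l) - 3 * v m)"
    by (simp add: step_def sum_of_enumeration_4[OF jkl])
  have B': "theta * potential (v i) (v j) (v k) (v l) \<le> theta * B"
    using B theta_bounds by simp
  have "m \<in> {i, j, k, l}"
    using assms(2) jkl(1) by auto
  then consider "m = j" | "m = k" | "m = l"
    using assms(3) by auto
  then show ?thesis
  proof cases
    case 1
    have "{j, i, k, l} = {..<4}" "distinct [j, i, k, l]"
      using jkl by auto
    moreover have "potential (2 * (v i + v k + v l) - v j) (v i) (v k) (v l) \<le> theta * B"
      using potential_step_le2[of "v l" "v k" "v j" "v i"] v B' by linarith
    moreover have "2 * (v i + v j + v k + v l) - 3 * v j = 2 * (v i + v k + v l) - v j"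
      by simp
    ultimately show ?thesis
      using v unfolding s unfolding 1 by (intro ordered_stateI[of j i k l]) (simp_all add: add.assoc)
  next
    case 2
    have "{k, i, j, l} = {..<4}" "distinct [k, i, j, l]"
      using jkl by auto
    moreover have "potential (2 * (v i + v j + v l) - v k) (v i) (v j) (v l) \<le> theta * B"
      using potential_step_le3[of "v l" "v k" "v i" "v j"] v B' by linarith
    moreover have "2 * (v i + v j + v k + v l) - 3 * v k = 2 * (v i + v j + v l) - v k"
      by simp
    ultimately show ?thesis
      using v unfolding s unfolding 2 by (intro ordered_stateI[of k i j l]) (simp_all add: add.assoc)
  next
    case 3
    have "{l, i, j, k} = {..<4}" "distinct [l, i, j, k]"
      using jkl by auto
    moreover have "potential (2 * (v i + v j + v k) - v l) (v i) (v j) (v k) \<le> theta * B"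
      using potential_step[of "v i" "v j" "v k" "v l"] B' by linarith
    moreover have "2 * (v i + v j + v k + v l) - 3 * v l = 2 * (v i + v j + v k) - v l"
      by simp
    ultimately show ?thesis
      using v unfolding s unfolding 3 by (intro ordered_stateI[of l i j k]) (simp_all add: add.assoc)
  qed
qed

lemma ordered_state_bounds:
  assumes "ordered_state v i B" "r < 4"
  shows "0 \<le> v r" "v r \<le> B"
proof -
  obtain j k l where jkl: "{i, j, k, l} = {..<4}"
    and v: "0 \<le> v l" "v l \<le> v k" "v k \<le> v j" "v j \<le> v i"
    and B: "potential (v i) (v j) (v k) (v l) \<le> B"
    using assms(1) by (auto simp: ordered_state_def)
  have "v i \<le> B"
    using potential_ge[of "v l" "v k" "v j" "v i"] v B by linarith
  moreover have "r \<in> {i, j, k, l}"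
    using assms(2) jkl by auto
  ultimately show "0 \<le> v r" "v r \<le> B"
    using v by auto
qed

text \<open>Here m stands for a letter that may be applied next. Quantifying over it lets the
  induction supply a largest entry other than the one about to change.\<close>

lemma ordered_state_act:
  assumes start: "\<And>m. m < 4 \<Longrightarrow> \<exists>i. i \<noteq> m \<and> ordered_state v i B"
    and "set w \<subseteq> {..<4}" "distinct_adj w" "m < 4" "w \<noteq> [] \<longrightarrow> m \<noteq> hd w"
  shows "\<exists>i. i \<noteq> m \<and> ordered_state (act w v) i (theta ^ length w * B)"
  using assms(2-)
proof (induction w arbitrary: m)
  case Nil
  then show ?case using start by simp
next
  case (Cons a w)
  then have "\<exists>i. i \<noteq> a \<and> ordered_state (act w v) i (theta ^ length w * B)"
    by (intro Cons.IH) (auto simp: distinct_adj_Cons)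
  then show ?case
    using Cons.prems ordered_state_step[of "act w v" _ "theta ^ length w * B" a]
    by (intro exI[of _ a]) (auto simp: mult.assoc)
qed

lemma act_bounds:
  assumes start: "\<And>m. m < 4 \<Longrightarrow> \<exists>i. i \<noteq> m \<and> ordered_state v i B"
    and w: "set w \<subseteq> {..<4}" and r: "r < 4" and B: "0 \<le> B"
  shows "0 \<le> act w v r \<and> act w v r \<le> theta ^ length w * B"
proof -
  obtain w' where w': "set w' \<subseteq> {..<4}" "distinct_adj w'" "length w' \<le> length w"
    "\<And>v :: nat \<Rightarrow> real. act w' v = act w v"
    using reduced_word[OF w] by metis
  \<comment> \<open>Any letter other than the head of w' can serve as the next letter in
    \<open>ordered_state_act\<close>.\<close>
  have "\<exists>m<4. w' \<noteq> [] \<longrightarrow> m \<noteq> hd w'"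
    by (rule exI[of _ "if hd w' = 0 then 1 else 0"]) auto
  then obtain i where "ordered_state (act w' v) i (theta ^ length w' * B)"
    using ordered_state_act[OF start w'(1,2)] by blast
  from ordered_state_bounds[OF this r]
  have "0 \<le> act w' v r" "act w' v r \<le> theta ^ length w' * B" .
  moreover have "theta ^ length w' * B \<le> theta ^ length w * B"
    using w'(3) theta_bounds B by (intro mult_right_mono power_increasing) auto
  ultimately show ?thesis
    by (simp add: w'(4))
qed

text \<open>All ones tie for the largest entry, so every i other than j can take that role. The
  bound 4 holds because no coefficient of the potential exceeds 1.\<close>

lemma ordered_state_0_1:
  assumes "i < 4" "j < 4" "i \<noteq> j" "c \<in> {0, 1}"
  shows "ordered_state ((\<lambda>_. 1)(j := c)) i 4"
proof -
  have "card ({..<4::nat} - {i, j}) = 2"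
    using assms by (simp add: card_Diff_subset)
  then obtain k l where kl: "{..<4} - {i, j} = {k, l}" "k \<noteq> l"
    by (auto simp: card_2_iff)
  then have "{i, k, l, j} = {..<4}" "distinct [i, k, l, j]"
    using assms by auto
  moreover have "potential 1 1 1 c \<le> 4"
    using assms coeff_bounds by (auto simp: potential_def)
  moreover have "0 \<le> c" "c \<le> 1"
    using assms by auto
  ultimately show ?thesis
    using assms(1-3) by (intro ordered_stateI[of i k l j]) simp_all
qed

section \<open>From nonnegative starting vectors to arbitrary complex ones\<close>

lemma step_diff: "step i (\<lambda>r. f r - g r) = (\<lambda>r. step i f r - step i g r)"
  by (auto simp: step_def fun_eq_iff sum_subtractf algebra_simps)

lemma act_diff: "act w (\<lambda>r. f r - g r) = (\<lambda>r. act w f r - act w g r)"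
  by (induction w) (simp_all add: step_diff)

text \<open>The unit vectors are not admissible starting vectors, so they are written as differences
  \<open>(1, 1, 1, 1) - ((1, 1, 1, 1) - e\<^sub>j)\<close>.\<close>

lemma act_unit_bound:
  assumes w: "set w \<subseteq> {..<4}" and "j < 4" "r < 4"
  shows "\<bar>act w (\<lambda>r. of_bool (r = j)) r\<bar> \<le> 4 * theta ^ length w"
proof -
  have start: "\<exists>i. i \<noteq> m \<and> ordered_state ((\<lambda>_. 1)(j := c)) i 4" if "m < 4" "c \<in> {0, 1}" for m c
  proof -
    \<comment> \<open>Four indices always leave one that avoids both m and j.\<close>
    have "card {m, j} < card {..<4::nat}"
      by (simp add: card_insert_if)
    then have "\<not> {..<4} \<subseteq> {m, j}"
      using card_mono[of "{m, j}" "{..<4}"] by fastforce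
    then obtain i where "i < 4" "i \<noteq> m" "i \<noteq> j" by auto
    then show ?thesis
      using ordered_state_0_1[of i j c] assms that by auto
  qed
  have "(\<lambda>r. of_bool (r = j)) = (\<lambda>r. ((\<lambda>_. 1)(j := 1)) r - ((\<lambda>_. 1)(j := 0 :: real)) r)"
    by (auto simp: fun_eq_iff)
  then have "act w (\<lambda>r. of_bool (r = j)) r
      = act w ((\<lambda>_. 1)(j := 1)) r - act w ((\<lambda>_. 1)(j := 0 :: real)) r"
    by (metis act_diff)
  \<comment> \<open>Both terms lie in the same interval starting at 0, so their difference is
    bounded by its length.\<close>
  moreover have "0 \<le> act w ((\<lambda>_. 1)(j := c)) r \<and> act w ((\<lambda>_. 1)(j := c)) r \<le> theta ^ length w * 4"
    if "c \<in> {0, 1}" for c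
    using that by (intro act_bounds start w assms) auto
  ultimately show ?thesis
    by (smt (verit) insert_iff mult.commute)
qed

lemma act_expand:
  fixes x :: "nat \<Rightarrow> complex"
  assumes "set w \<subseteq> {..<4}" "r < 4"
  shows "act w x r = (\<Sum>j<4. x j * of_real (act w (\<lambda>r. of_bool (r = j)) r))"
  using assms
proof (induction w arbitrary: r)
  case Nil
  then show ?case
    by (auto elim!: less_4_cases simp: sum_lessThan_4)
next
  case (Cons i w)
  then have "i < 4" by simp
  let ?u = "\<lambda>j. act w (\<lambda>r. of_bool (r = j)) :: nat \<Rightarrow> real"
  have IH: "act w x s = (\<Sum>j<4. x j * of_real (?u j s))" if "s < 4" for s
    using Cons that by auto
  have "2 * (\<Sum>s<4. act w x s) - 3 * act w x i
      = (\<Sum>j<4. x j * of_real (2 * (\<Sum>s<4. ?u j s) - 3 * ?u j i))"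
    using \<open>i < 4\<close> by (simp add: IH) (simp add: sum_lessThan_4 algebra_simps)
  then show ?case
    using Cons.prems IH by (simp add: step_def)
qed

text \<open>The constant 16 is four unit vectors times the factor 4 of
  \<open>act_unit_bound\<close>.\<close>

lemma act_bound:
  fixes x :: "nat \<Rightarrow> complex"
  assumes w: "set w \<subseteq> {..<4}" and r: "r < 4" and x: "\<And>j. j < 4 \<Longrightarrow> cmod (x j) \<le> b"
  shows "cmod (act w x r) \<le> 16 * theta ^ length w * b"
proof -
  have "cmod (act w x r) \<le> (\<Sum>j<4. cmod (x j) * \<bar>act w (\<lambda>r. of_bool (r = j)) r\<bar>)"
    unfolding act_expand[OF w r] by (rule sum_norm_le) (simp add: norm_mult)
  also have "\<dots> \<le> (\<Sum>j<(4::nat). b * (4 * theta ^ length w))"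
    using x order.trans[OF norm_ge_zero x]
    by (intro sum_mono mult_mono act_unit_bound w r) auto
  finally show ?thesis
    by (simp add: mult_ac)
qed

section \<open>Words as matrices and their eigenvalues\<close>

abbreviation word_mat :: "nat list \<Rightarrow> complex mat" where
  "word_mat w \<equiv> mat_prod_list 4 (map (\<lambda>i. apollonian_Sc (Suc i)) w)"

lemma word_mat_carrier [simp]: "word_mat w \<in> carrier_mat 4 4"
  by (induction w) (auto simp: mat_prod_list_def intro!: mult_carrier_mat)

lemma word_mat_Cons: "word_mat (i # w) = apollonian_Sc (Suc i) * word_mat w"
  by (simp add: mat_prod_list_def)

lemma apollonian_Sc_mult_vec:
  assumes "i < 4"
  shows "apollonian_Sc (Suc i) *\<^sub>v vec 4 x = vec 4 (step i x)"
proof (rule eq_vecI)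
  fix r assume "r < dim_vec (vec 4 (step i x))"
  then have r: "r < 4" by simp
  have "(apollonian_Sc (Suc i) *\<^sub>v vec 4 x) $ r
      = (\<Sum>j<4. of_int (apollonian_S (Suc i) $$ (r, j)) * x j)"
    using r by (simp add: apollonian_S_def scalar_prod_def atLeast0LessThan)
  also have "\<dots> = step i x r"
    using r assms by (elim less_4_cases)
      (simp_all add: sum_lessThan_4 apollonian_S_def step_def algebra_simps)
  finally show "(apollonian_Sc (Suc i) *\<^sub>v vec 4 x) $ r = vec 4 (step i x) $ r"
    using r by simp
qed (simp add: apollonian_S_def)

lemma word_mat_mult_vec:
  assumes "set w \<subseteq> {..<4}"
  shows "word_mat w *\<^sub>v vec 4 x = vec 4 (act w x)"
  using assms
proof (induction w)
  case Nil
  then show ?case by (simp add: mat_prod_list_def)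
next
  case (Cons i w)
  then have "word_mat (i # w) *\<^sub>v vec 4 x = apollonian_Sc (Suc i) *\<^sub>v (word_mat w *\<^sub>v vec 4 x)"
    unfolding word_mat_Cons by (intro assoc_mult_mat_vec[of _ 4 4 _ 4]) auto
  then show ?case
    using Cons by (simp add: apollonian_Sc_mult_vec)
qed

lemma act_append: "act (u @ w) v = act u (act w v)"
  by (simp add: act_def)

lemma step_cong: "(\<And>r. r < 4 \<Longrightarrow> f r = g r) \<Longrightarrow> i < 4 \<Longrightarrow> r < 4 \<Longrightarrow> step i f r = step i g r"
  by (simp add: step_def)

text \<open>Eigenvector equations are known only at indices below 4, so they cannot be used as
  equalities of functions.\<close>

lemma act_cong:
  assumes "\<And>r. r < 4 \<Longrightarrow> f r = g r" "set w \<subseteq> {..<4}" "r < 4"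
  shows "act w f r = act w g r"
  using assms(2,3) by (induction w arbitrary: r) (auto simp: assms(1) intro: step_cong)

lemma step_scale: "step i (\<lambda>r. a * f r) = (\<lambda>r. a * step i f r)"
  by (auto simp: step_def fun_eq_iff sum_distrib_left algebra_simps)

lemma act_scale: "act w (\<lambda>r. a * f r) = (\<lambda>r. a * act w f r)"
  by (induction w) (simp_all add: step_scale)

lemma act_power:
  assumes w: "set w \<subseteq> {..<4}" and ev: "\<And>r. r < 4 \<Longrightarrow> act w x r = a * x r" and r: "r < 4"
  shows "act (concat (replicate m w)) x r = a ^ m * x r"
  using r
proof (induction m arbitrary: r)
  case (Suc m)
  have "act (concat (replicate (Suc m) w)) x r = act w (act (concat (replicate m w)) x) r"
    by (simp add: act_append)
  also have "\<dots> = act w (\<lambda>r. a ^ m * x r) r"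
    using Suc w by (intro act_cong) auto
  also have "\<dots> = a ^ Suc m * x r"
    using Suc.prems by (simp add: act_scale ev)
  finally show ?case .
qed simp

lemma eigenvalue_word_mat_iff:
  assumes "set w \<subseteq> {..<4}"
  shows "eigenvalue (word_mat w) a \<longleftrightarrow>
    (\<exists>x. (\<exists>r<4. x r \<noteq> 0) \<and> (\<forall>r<4. act w x r = a * x r))"
proof
  assume "eigenvalue (word_mat w) a"
  then obtain v where v: "v \<in> carrier_vec 4" "v \<noteq> 0\<^sub>v 4" "word_mat w *\<^sub>v v = a \<cdot>\<^sub>v v"
    using word_mat_carrier[of w] by (auto simp: eigenvalue_def eigenvector_def)
  have v_eq: "v = vec 4 (($) v)"
    using v(1) by auto
  then have "vec 4 (act w (($) v)) = a \<cdot>\<^sub>v v"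
    using word_mat_mult_vec[OF assms, of "($) v"] v(3) by simp
  then have "act w (($) v) r = a * v $ r" if "r < 4" for r
    using that v(1) by (metis carrier_vecD index_smult_vec(1) index_vec)
  moreover have "\<exists>r<4. v $ r \<noteq> 0"
    using v(1,2) by (metis carrier_vecD eq_vecI index_zero_vec)
  ultimately show "\<exists>x. (\<exists>r<4. x r \<noteq> 0) \<and> (\<forall>r<4. act w x r = a * x r)"
    by auto
next
  assume "\<exists>x. (\<exists>r<4. x r \<noteq> 0) \<and> (\<forall>r<4. act w x r = a * x r)"
  then obtain x r where x: "r < 4" "x r \<noteq> 0" "\<And>r. r < 4 \<Longrightarrow> act w x r = a * x r"
    by auto
  have "vec 4 x \<noteq> 0\<^sub>v 4"
    using x(1,2) by (metis index_vec index_zero_vec(1))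
  moreover have "word_mat w *\<^sub>v vec 4 x = a \<cdot>\<^sub>v vec 4 x"
    unfolding word_mat_mult_vec[OF assms] using x(3) by auto
  ultimately have "eigenvector (word_mat w) (vec 4 x) a"
    using carrier_matD(1)[OF word_mat_carrier[of w]] by (simp add: eigenvector_def)
  then show "eigenvalue (word_mat w) a"
    by (auto simp: eigenvalue_def)
qed

section \<open>Upper bound for the spectral radius\<close>

text \<open>If a / b exceeded 1, its powers would outgrow the constant c.\<close>

lemma le_if_powers_bounded:
  fixes a b :: real
  assumes "0 < b" and le: "\<And>m. a ^ m \<le> c * b ^ m"
  shows "a \<le> b"
proof (rule ccontr)
  assume "\<not> a \<le> b"
  then have "1 < a / b"
    using assms by simp
  then obtain m where "c < (a / b) ^ m"
    using real_arch_pow by blast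
  then show False
    using le[of m] assms(1) by (simp add: field_simps)
qed

lemma eigenvalue_word_mat_le:
  assumes w: "set w \<subseteq> {..<4}" and "eigenvalue (word_mat w) a"
  shows "cmod a \<le> theta ^ length w"
proof -
  obtain x q where x: "q < 4" "x q \<noteq> 0" "\<And>r. r < 4 \<Longrightarrow> act w x r = a * x r"
    using assms eigenvalue_word_mat_iff[OF w] by auto
  \<comment> \<open>The entry bound is read off at an entry of maximal modulus, so that b appears on
    both sides and cancels.\<close>
  define b where "b = Max ((\<lambda>r. cmod (x r)) ` {..<4})"
  have b_ge: "cmod (x r) \<le> b" if "r < 4" for r
    using that by (auto simp: b_def)
  have "b \<in> (\<lambda>r. cmod (x r)) ` {..<4}"
    unfolding b_def by (rule Max_in) (auto simp: lessThan_empty_iff)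
  then obtain r where r: "r < 4" "b = cmod (x r)" by auto
  have "0 < b"
    using b_ge[OF x(1)] x(2) by (smt (verit) zero_less_norm_iff)
  have "cmod a ^ m \<le> 16 * (theta ^ length w) ^ m" for m
  proof -
    have "set (concat (replicate m w)) \<subseteq> {..<4}"
      using w by auto
    then have "cmod (act (concat (replicate m w)) x r)
        \<le> 16 * theta ^ length (concat (replicate m w)) * b"
      using r(1) b_ge by (rule act_bound)
    then have "cmod a ^ m * b \<le> 16 * theta ^ (length w * m) * b"
      using act_power[OF w x(3) r(1)] r(2)
      by (simp add: norm_mult norm_power length_concat sum_list_replicate mult.commute)
    then show ?thesis
      using \<open>0 < b\<close> by (simp add: power_mult)
  qed
  then show ?thesis
    by (rule le_if_powers_bounded[rotated]) (use theta_bounds in simp)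
qed

lemma spectral_radius_word_mat_le:
  assumes "set w \<subseteq> {..<4}"
  shows "spectral_radius (word_mat w) \<le> theta ^ length w"
  using spectral_radius_mem_max(1)[OF word_mat_carrier[of w]] eigenvalue_word_mat_le[OF assms]
  by (auto simp: spectrum_def)

section \<open>The extremal cyclic word\<close>

definition cyclic_word :: "nat list" where
  "cyclic_word = [3, 2, 1, 0]"

lemma set_cyclic_word: "set cyclic_word \<subseteq> {..<4}"
  by (simp add: cyclic_word_def)

text \<open>The geometric sequence x solves the recurrence of order 4, and each letter replaces x n
  by x (n + 4). Four letters therefore shift the window x 0, ..., x 3 to x 4, ..., x 7, which
  multiplies it by theta^4.\<close>

lemma act_cyclic_word:
  fixes x :: "nat \<Rightarrow> complex"
  assumes x: "x = (\<lambda>r. of_real theta ^ r)" and "r < 4"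
  shows "act cyclic_word x r = of_real (theta ^ 4) * x r"
proof -
  have t4: "complex_of_real theta ^ 4
      = 2 * of_real theta ^ 3 + 2 * of_real theta ^ 2 + 2 * of_real theta - 1"
    using arg_cong[OF theta_pow4, of complex_of_real] by simp
  have rec: "2 * x (n + 3) + 2 * x (n + 2) + 2 * x (n + 1) - x n = x (n + 4)" for n
    unfolding x by (simp only: power_add t4) (simp add: algebra_simps)
  have "step 0 x = x(0 := x 4)"
    using rec[of 0] by (intro step_eqI) (simp add: sum_lessThan_4 eval_nat_numeral algebra_simps)
  moreover have "step 1 (x(0 := x 4)) = x(0 := x 4, 1 := x 5)"
    using rec[of 1] by (intro step_eqI) (simp add: sum_lessThan_4 eval_nat_numeral algebra_simps)
  moreover have "step 2 (x(0 := x 4, 1 := x 5)) = x(0 := x 4, 1 := x 5, 2 := x 6)"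
    using rec[of 2] by (intro step_eqI) (simp add: sum_lessThan_4 eval_nat_numeral algebra_simps)
  moreover have "step 3 (x(0 := x 4, 1 := x 5, 2 := x 6))
      = x(0 := x 4, 1 := x 5, 2 := x 6, 3 := x 7)"
    using rec[of 3] by (intro step_eqI) (simp add: sum_lessThan_4 eval_nat_numeral algebra_simps)
  ultimately have "act cyclic_word x = x(0 := x 4, 1 := x 5, 2 := x 6, 3 := x 7)"
    by (simp add: cyclic_word_def)
  then have "act cyclic_word x r = x (4 + r)"
    using \<open>r < 4\<close> by (elim less_4_cases) simp_all
  then show ?thesis
    by (simp add: x power_add)
qed

text \<open>Powers of the cyclic word attain the upper bound at every length divisible by 4, as the
  limit superior requires; m = 1 gives the matrix of the theorem.\<close>

lemma spectral_radius_cyclic_power: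
  defines "w \<equiv> \<lambda>m. concat (replicate m cyclic_word)"
  shows "spectral_radius (word_mat (w m)) = theta ^ (4 * m)"
proof (rule antisym)
  have w: "set (w m) \<subseteq> {..<4}"
    using set_cyclic_word by (auto simp: w_def)
  have "length (w m) = 4 * m"
    by (simp add: w_def length_concat sum_list_replicate cyclic_word_def)
  then show "spectral_radius (word_mat (w m)) \<le> theta ^ (4 * m)"
    using spectral_radius_word_mat_le[OF w] by simp
  define x where "x = (\<lambda>r. complex_of_real theta ^ r)"
  have "\<forall>r<4. act (w m) x r = of_real (theta ^ 4) ^ m * x r"
    unfolding w_def using act_power[OF set_cyclic_word act_cyclic_word[OF x_def]] by blast
  moreover have "x 0 \<noteq> 0"
    by (simp add: x_def)
  ultimately have "eigenvalue (word_mat (w m)) (of_real (theta ^ 4) ^ m)"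
    unfolding eigenvalue_word_mat_iff[OF w] by (intro exI[of _ x] conjI exI[of _ 0]) auto
  then have "cmod (of_real (theta ^ 4) ^ m) \<le> spectral_radius (word_mat (w m))"
    by (intro spectral_radius_mem_max(2)[of _ 4]) (auto simp: spectrum_def)
  then show "theta ^ (4 * m) \<le> spectral_radius (word_mat (w m))"
    using theta_bounds by (simp add: norm_power power_mult)
qed

section \<open>The joint spectral radius\<close>

lemma spectral_radius_nonneg: "0 \<le> spectral_radius (word_mat w)"
  using spectral_radius_mem_max(1)[OF word_mat_carrier[of w]] by auto

text \<open>Lists over the four generators are the images of words over 0, ..., 3, which shows the
  maximum to be over a finite set and makes the bounds for words applicable.\<close>

lemma jsr_set_eq:
  "{spectral_radius (mat_prod_list 4 Ms) powr (1 / real k) | Ms.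
      length Ms = k \<and> set Ms \<subseteq> apollonian_Sc ` {1..4}}
    = (\<lambda>w. spectral_radius (word_mat w) powr (1 / real k)) ` {w. set w \<subseteq> {..<4} \<and> length w = k}"
proof -
  let ?S = "\<lambda>i. apollonian_Sc (Suc i)"
  have "apollonian_Sc ` {1..4} = ?S ` {..<4}"
    by (simp add: image_Suc_lessThan flip: image_image[of apollonian_Sc Suc])
  then have eq: "{Ms. set Ms \<subseteq> apollonian_Sc ` {1..4}} = map ?S ` {w. set w \<subseteq> {..<4}}"
    using lists_image[of ?S "{..<4}"] by (simp only: lists_eq_set)
  have "{Ms. length Ms = k \<and> set Ms \<subseteq> apollonian_Sc ` {1..4}}
      = {Ms \<in> {Ms. set Ms \<subseteq> apollonian_Sc ` {1..4}}. length Ms = k}"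
    by blast
  also have "\<dots> = {Ms \<in> map ?S ` {w. set w \<subseteq> {..<4}}. length Ms = k}"
    by (simp only: eq)
  also have "\<dots> = map ?S ` {w. set w \<subseteq> {..<4} \<and> length w = k}"
    by auto
  finally have "{Ms. length Ms = k \<and> set Ms \<subseteq> apollonian_Sc ` {1..4}}
      = map ?S ` {w. set w \<subseteq> {..<4} \<and> length w = k}" .
  moreover have "{f Ms | Ms. length Ms = k \<and> set Ms \<subseteq> apollonian_Sc ` {1..4}}
      = f ` {Ms. length Ms = k \<and> set Ms \<subseteq> apollonian_Sc ` {1..4}}"
    for f :: "complex mat list \<Rightarrow> real"
    by blast
  ultimately show ?thesis
    by (simp only: image_image)
qed

lemma theta_root: "k > 0 \<Longrightarrow> (theta ^ k) powr (1 / real k) = theta"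
  using theta_bounds by (simp add: powr_powr flip: powr_realpow)

lemma jsr_eq_theta: "joint_spectral_radius 4 (apollonian_Sc ` {1..4}) = ereal theta"
proof -
  define W where "W k = {w :: nat list. set w \<subseteq> {..<4} \<and> length w = k}" for k
  define rho where "rho k = Max ((\<lambda>w. spectral_radius (word_mat w) powr (1 / real k)) ` W k)" for k
  have fin: "finite (W k)" for k
    unfolding W_def by (rule finite_lists_length_eq) simp
  have "replicate k 0 \<in> W k" for k
    by (auto simp: W_def)
  then have ne: "W k \<noteq> {}" for k
    by blast
  have "rho k \<le> theta" if "k > 0" for k
  proof -
    have "spectral_radius (word_mat w) powr (1 / real k) \<le> theta" if "w \<in> W k" for w
    proof -
      have "spectral_radius (word_mat w) powr (1 / real k) \<le> (theta ^ k) powr (1 / real k)"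
        using spectral_radius_word_mat_le[of w] that spectral_radius_nonneg[of w]
        by (intro powr_mono2) (auto simp: W_def)
      then show ?thesis
        using theta_root[OF \<open>k > 0\<close>] by simp
    qed
    then show ?thesis
      using fin ne by (simp add: rho_def)
  qed
  then have "limsup (\<lambda>k. ereal (rho k)) \<le> ereal theta"
    \<comment> \<open>The bound comes from \<open>theta_root\<close>, which needs k > 0 because
      \<open>1 / real 0\<close> is 0; it holds eventually, from k = 1 on.\<close>
    by (intro Limsup_bounded) (auto simp: eventually_sequentially intro!: exI[of _ 1])
  \<comment> \<open>Lengths divisible by 4 form a subsequence whose limit superior bounds the full
    one from below; \<open>Suc\<close> excludes length 0.\<close>
  moreover have "theta \<le> rho (4 * Suc m)" for m
  proof -
    let ?w = "concat (replicate (Suc m) cyclic_word)"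
    have "?w \<in> W (4 * Suc m)"
      using set_cyclic_word
      by (auto simp: W_def length_concat sum_list_replicate cyclic_word_def)
    then have "spectral_radius (word_mat ?w) powr (1 / real (4 * Suc m)) \<le> rho (4 * Suc m)"
      unfolding rho_def by (intro Max_ge finite_imageI fin imageI)
    then show ?thesis
      using theta_root[of "4 * Suc m"] by (simp only: spectral_radius_cyclic_power) simp
  qed
  then have "ereal theta \<le> limsup ((\<lambda>k. ereal (rho k)) \<circ> (\<lambda>m. 4 * Suc m))"
    by (intro le_Limsup) auto
  then have "ereal theta \<le> limsup (\<lambda>k. ereal (rho k))"
    by (rule order.trans) (intro limsup_subseq_mono, simp add: strict_mono_def)
  ultimately show ?thesis
    unfolding joint_spectral_radius_def jsr_set_eq by (simp add: rho_def W_def)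
qed

theorem theorem7p2:
  fixes \<theta> :: real and M :: "complex mat"
  defines "\<theta> \<equiv> (1 / 2) * (1 + sqrt 5 + sqrt (2 + 2 * sqrt 5))"
    and "M \<equiv> apollonian_Sc 4 * apollonian_Sc 3 * apollonian_Sc 2 * apollonian_Sc 1"
  shows "joint_spectral_radius 4 (apollonian_Sc ` {1..4}) = ereal \<theta>
    \<and> \<bar>\<theta> - 2.890\<bar> < 0.0005
    \<and> ereal (spectral_radius M powr (1 / 4)) = joint_spectral_radius 4 (apollonian_Sc ` {1..4})"
proof -
  have \<theta>: "\<theta> = theta"
    by (simp add: \<theta>_def theta_def)
  \<comment> \<open>Reassociated to the right, to match the \<open>foldr\<close> in
    \<open>mat_prod_list\<close>, which also appends an identity matrix.\<close>
  have "M = apollonian_Sc 4 * (apollonian_Sc 3 * (apollonian_Sc 2 * apollonian_Sc 1))"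
    unfolding M_def by (simp add: assoc_mult_mat[of _ 4 4 _ 4 _ 4] mult_carrier_mat[of _ 4 4 _ 4])
  then have "M = word_mat cyclic_word"
    by (simp add: cyclic_word_def mat_prod_list_def right_mult_one_mat[of _ 4 4])
      (simp add: numeral_2_eq_2)
  then have "spectral_radius M = theta ^ 4"
    using spectral_radius_cyclic_power[of 1] by simp
  then have "spectral_radius M powr (1 / 4) = theta"
    using theta_root[of 4] by simp
  then show ?thesis
    unfolding \<theta> jsr_eq_theta using theta_bounds by (simp add: abs_if)
qed

end
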